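(* Let $k\in\mathbb{N}$ and let $G$ be a graph with (edge) arboricity $2$. If $k\ge\lceil(\Delta(G)+1)/2\rceil$, then $G$ is equitably $k$-list arborable.
   Context: Graphs are finite and simple. The (edge) arboricity of $G$ is the minimum number of forests into which $E(G)$ can be partitioned. $\Delta(G)$ is the maximum degree. A $k$-uniform list assignment $L$ for $G$ assigns to each vertex $v$ a set $L(v)$ of exactly $k$ colours; an $L$-colouring is a map $c$ with $c(v)\in L(v)$; it is equitable if every colour class has at most $\lceil |V(G)|/k\rceil$ vertices. $G$ is equitably $k$-list arborable if for every $k$-uniform list assignment $L$ there is an equitable $L$-colouring of $G$ in which every colour class induces an acyclic subgraph. *)

theory Defs
  imports Complex_Main "HOL-Library.Disjoint_Sets"
begin

definition simple_graph :: "'a set \<Rightarrow> 'a set set \<Rightarrow> bool" where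
  "simple_graph V E \<longleftrightarrow> finite V \<and> (\<forall>e\<in>E. e \<subseteq> V \<and> card e = 2)"

definition degree :: "'a set set \<Rightarrow> 'a \<Rightarrow> nat" where
  "degree E v = card {e \<in> E. v \<in> e}"

definition max_degree :: "'a set \<Rightarrow> 'a set set \<Rightarrow> nat" where
  "max_degree V E = Max (degree E ` V)"

definition is_cycle :: "'a set set \<Rightarrow> 'a list \<Rightarrow> bool" where
  "is_cycle E p \<longleftrightarrow> 3 \<le> length p \<and> distinct p \<and>
     (\<forall>i<length p. {p ! i, p ! (Suc i mod length p)} \<in> E)"

text \<open>Isolated vertices are irrelevant to acyclicity, so it is a predicate on edge sets.\<close>

definition forest :: "'a set set \<Rightarrow> bool" where
  "forest E \<longleftrightarrow> (\<nexists>p. is_cycle E p)"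

text \<open>The parts of \<^const>\<open>partition_on\<close> are nonempty, which does not affect the minimum.
  For finite \<open>E\<close> consisting of two-element sets the minimum exists, because
  the partition of \<open>E\<close> into singletons is a partition into forests.\<close>

definition arboricity :: "'a set set \<Rightarrow> nat" where
  "arboricity E =
     (LEAST n. \<exists>P. partition_on E P \<and> finite P \<and> card P = n \<and> (\<forall>F\<in>P. forest F))"

definition induced_edges :: "'a set set \<Rightarrow> 'a set \<Rightarrow> 'a set set" where
  "induced_edges E S = {e \<in> E. e \<subseteq> S}"

definition uniform_list_assignment :: "nat \<Rightarrow> 'a set \<Rightarrow> ('a \<Rightarrow> 'c set) \<Rightarrow> bool" where
  "uniform_list_assignment k V L \<longleftrightarrow> (\<forall>v\<in>V. finite (L v) \<and> card (L v) = k)"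

definition list_colouring :: "'a set \<Rightarrow> ('a \<Rightarrow> 'c set) \<Rightarrow> ('a \<Rightarrow> 'c) \<Rightarrow> bool" where
  "list_colouring V L c \<longleftrightarrow> (\<forall>v\<in>V. c v \<in> L v)"

definition colour_class :: "'a set \<Rightarrow> ('a \<Rightarrow> 'c) \<Rightarrow> 'c \<Rightarrow> 'a set" where
  "colour_class V c x = {v \<in> V. c v = x}"

definition equitable :: "nat \<Rightarrow> 'a set \<Rightarrow> ('a \<Rightarrow> 'c) \<Rightarrow> bool" where
  "equitable k V c \<longleftrightarrow>
     (\<forall>x. int (card (colour_class V c x)) \<le> \<lceil>real (card V) / real k\<rceil>)"

text \<open>The first argument fixes the type from which colours are drawn; a theorem with
  free \<open>'c\<close> covers lists of colours of every type.\<close>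

definition equitably_list_arborable ::
    "'c itself \<Rightarrow> nat \<Rightarrow> 'a set \<Rightarrow> 'a set set \<Rightarrow> bool" where
  "equitably_list_arborable _ k V E \<longleftrightarrow>
     (\<forall>L :: 'a \<Rightarrow> 'c set. uniform_list_assignment k V L \<longrightarrow>
        (\<exists>c. list_colouring V L c \<and> equitable k V c \<and>
             (\<forall>x. forest (induced_edges E (colour_class V c x)))))"

end

theory Submission
  imports Defs
begin

text \<open>Arboricity 2 makes the degree sum of every nonempty induced subgraph on \<open>W\<close> at most
  \<open>4 |W| - 4\<close>, and the bound on \<open>k\<close> says \<open>\<Delta> \<le> 2k - 1\<close>. For \<open>k \<ge> 3\<close> one removes \<open>k\<close> vertices, colours the
  rest by induction, and gives the removed vertices distinct colours, so that every class grows by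
  at most one. A vertex coloured after \<open>j\<close> of the removed ones still has \<open>k - j\<close> colours, so it can be
  added as a leaf if it has fewer than \<open>2(k - j)\<close> neighbours among the vertices that were kept. As
  there is always a vertex of degree at most 3, only the last vertex is critical, and it is
  harmless if it has degree at most 2, or degree 3 and a neighbour of degree less than \<open>2k - 1\<close>.
  Otherwise counting the edges at vertices of degree 3 shows that \<open>k = 3\<close> and that some vertex has
  three neighbours of degree 3; around it six vertices are removed at once. For \<open>k = 2\<close> sparsity plays
  no role: a greedy colouring into forests is rebalanced one vertex at a time.\<close>

section \<open>Acyclic vertex sets and colours that are rare on a set\<close>

text \<open>Stands for acyclicity of the subgraph induced on \<open>S\<close>: a finite graph is a
  forest iff every nonempty vertex set has a member with at most one neighbour in it. In this form
  the property passes to subsets and survives adding a leaf, so cycles appear only in the link with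
  \<open>forest\<close>.\<close>

definition one_degenerate :: "('a \<Rightarrow> 'a set) \<Rightarrow> 'a set \<Rightarrow> bool" where
  "one_degenerate N S \<longleftrightarrow> (\<forall>W\<subseteq>S. W \<noteq> {} \<longrightarrow> (\<exists>v\<in>W. card (N v \<inter> W) \<le> 1))"

lemma one_degenerate_empty [simp]: "one_degenerate N {}"
  by (auto simp: one_degenerate_def)

lemma one_degenerate_mono: "one_degenerate N S \<Longrightarrow> T \<subseteq> S \<Longrightarrow> one_degenerate N T"
  by (meson one_degenerate_def subset_trans)

text \<open>In a subset containing \<open>x\<close>, the vertex \<open>x\<close> itself is the
  witness; any other subset lies in \<open>S\<close>.\<close>

lemma one_degenerate_insert:
  assumes S: "one_degenerate N S" and fin: "finite S" and irr: "x \<notin> N x"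
    and x: "card (N x \<inter> S) \<le> 1"
  shows "one_degenerate N (insert x S)"
  unfolding one_degenerate_def
proof (intro allI impI)
  fix W assume W: "W \<subseteq> insert x S" "W \<noteq> {}"
  show "\<exists>v\<in>W. card (N v \<inter> W) \<le> 1"
  proof (cases "x \<in> W")
    case True
    have "N x \<inter> W \<subseteq> N x \<inter> S" using W irr by auto
    then have "card (N x \<inter> W) \<le> card (N x \<inter> S)" using fin by (auto intro: card_mono)
    then show ?thesis using x True by force
  next
    case False
    then have "W \<subseteq> S" using W by auto
    then show ?thesis using S W(2) by (auto simp: one_degenerate_def)
  qed
qed

lemma double_multiplicity_card:
  assumes "finite C" "finite X"
  shows "2 * card {a\<in>C. \<not> card {x\<in>X. f x = a} \<le> 1} \<le> card X"
proof -
  let ?B = "{a\<in>C. \<not> card {x\<in>X. f x = a} \<le> 1}"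
  have "2 * card ?B = (\<Sum>a\<in>?B. 2)" by simp
  also have "\<dots> \<le> (\<Sum>a\<in>?B. card {x\<in>X. f x = a})" by (intro sum_mono) auto
  also have "\<dots> = card (\<Union>a\<in>?B. {x\<in>X. f x = a})"
    using assms by (intro card_UN_disjoint[symmetric]) auto
  also have "\<dots> \<le> card X" using assms by (intro card_mono) auto
  finally show ?thesis .
qed

text \<open>A repeated colour takes up two elements of \<open>X\<close>, so fewer than
  \<open>j\<close> colours are repeated. In the applications \<open>X\<close> consists of coloured
  neighbours of a vertex; a colour seen at most once among them can be given to that vertex without
  closing a cycle.\<close>

lemma few_repetitions_card:
  assumes "finite C" "finite X" "card X < 2 * j"
  shows "card C < card {a\<in>C. card {x\<in>X. f x = a} \<le> 1} + j"
proof -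
  let ?G = "{a\<in>C. card {x\<in>X. f x = a} \<le> 1}" and ?B = "{a\<in>C. \<not> card {x\<in>X. f x = a} \<le> 1}"
  have "card C = card (?G \<union> ?B)" by (rule arg_cong[where f=card]) auto
  also have "\<dots> = card ?G + card ?B" using assms by (intro card_Un_disjoint) auto
  finally show ?thesis using double_multiplicity_card[OF assms(1,2), of f] assms(3) by linarith
qed

lemma exists_rare_colour:
  assumes "finite C" "finite X" "card X < 2 * card C"
  obtains a where "a \<in> C" "card {x\<in>X. f x = a} \<le> 1"
  using few_repetitions_card[OF assms, of f] assms(1)
  by (metis (mono_tags, lifting) add_less_same_cancel2 card.empty empty_Collect_eq not_less0 add_0 less_irrefl)

lemma obtain_outside:
  assumes "finite Y" "card Y < card X"
  obtains a where "a \<in> X" "a \<notin> Y"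
  using assms by (metis card_mono not_le subsetI)

lemma obtain_third:
  assumes "card X = 3"
  obtains a where "a \<in> X" "a \<noteq> x" "a \<noteq> y"
proof -
  have "card {x,y} < card X" using assms by (simp add: card_insert_if)
  then obtain a where "a \<in> X" "a \<notin> {x,y}" using obtain_outside[of "{x,y}" X] by blast
  then show thesis using that by blast
qed

section \<open>List-assigned graphs and the extension of partial colourings\<close>

text \<open>\<open>deg_bound\<close> is the hypothesis \<Delta> \<le> 2k - 1. Neighbourhoods are
  counted only inside a given vertex set, so induced subgraphs need no edge sets of their
  own.\<close>

locale list_assigned_graph =
  fixes V :: "'a set" and N :: "'a \<Rightarrow> 'a set" and L :: "'a \<Rightarrow> 'c set" and k :: nat
  assumes finite_V: "finite V"
    and sym: "w \<in> N v \<Longrightarrow> v \<in> N w"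
    and irrefl: "v \<notin> N v"
    and finite_L: "v \<in> V \<Longrightarrow> finite (L v)"
    and card_L: "v \<in> V \<Longrightarrow> card (L v) = k"
    and deg_bound: "v \<in> V \<Longrightarrow> card (N v \<inter> V) < 2 * k"
begin

definition arborable_on :: "('a \<Rightarrow> 'c) \<Rightarrow> 'a set \<Rightarrow> bool" where
  "arborable_on c W \<longleftrightarrow> (\<forall>v\<in>W. c v \<in> L v) \<and> (\<forall>x. one_degenerate N {v\<in>W. c v = x})"

definition colourable :: "'a set \<Rightarrow> nat \<Rightarrow> bool" where
  "colourable W m \<longleftrightarrow> (\<exists>c. arborable_on c W \<and> (\<forall>x. card {v\<in>W. c v = x} \<le> m))"

text \<open>The invariant while removed vertices are put back: \<open>U\<close> is kept and coloured
  with classes of size at most \<open>m\<close>, and the vertices of \<open>D\<close>, already put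
  back, have pairwise distinct colours. Hence each class on the union has at most
  \<open>m + 1\<close> vertices.\<close>

definition extension :: "nat \<Rightarrow> 'a set \<Rightarrow> 'a set \<Rightarrow> ('a \<Rightarrow> 'c) \<Rightarrow> bool" where
  "extension m U D c \<longleftrightarrow>
     arborable_on c (U \<union> D) \<and> (\<forall>x. card {v\<in>U. c v = x} \<le> m) \<and> inj_on c D"

lemma finite_sub: "W \<subseteq> V \<Longrightarrow> finite W"
  using finite_V finite_subset by blast

lemma card_nbrs_mono: "W \<subseteq> V \<Longrightarrow> U \<subseteq> W \<Longrightarrow> card (N v \<inter> U) \<le> card (N v \<inter> W)"
  by (intro card_mono) (auto dest: finite_sub)

lemma card_nbrs_less:
  assumes "W \<subseteq> V" "U \<subseteq> W" "x \<in> N v" "x \<in> W" "x \<notin> U"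
  shows "card (N v \<inter> U) < card (N v \<inter> W)"
  using assms by (intro psubset_card_mono) (auto dest: finite_sub)

lemma arborable_on_update_class:
  assumes c: "arborable_on c W" and x: "x \<notin> W" "a \<in> L x"
    and deg: "one_degenerate N (insert x {v\<in>W. c v = a})"
  shows "arborable_on (c(x := a)) (insert x W)"
  unfolding arborable_on_def
proof (intro conjI allI ballI)
  fix v assume "v \<in> insert x W"
  then show "(c(x := a)) v \<in> L v" using c x by (auto simp: arborable_on_def)
next
  fix y
  have "{v \<in> insert x W. (c(x := a)) v = y} =
      (if y = a then insert x {v\<in>W. c v = a} else {v\<in>W. c v = y})"
    using x by auto
  then show "one_degenerate N {v \<in> insert x W. (c(x := a)) v = y}"
    using c deg by (simp add: arborable_on_def)
qed

lemma arborable_on_update: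
  assumes c: "arborable_on c W" and W: "W \<subseteq> V" and x: "x \<notin> W" "a \<in> L x"
    and deg: "card {v \<in> N x \<inter> W. c v = a} \<le> 1"
  shows "arborable_on (c(x := a)) (insert x W)"
proof (rule arborable_on_update_class[OF c x], rule one_degenerate_insert)
  show "finite {v\<in>W. c v = a}" using finite_sub[OF W] by simp
  have "N x \<inter> {v\<in>W. c v = a} = {v \<in> N x \<inter> W. c v = a}" by auto
  then show "card (N x \<inter> {v\<in>W. c v = a}) \<le> 1" using deg by simp
qed (use c irrefl in \<open>auto simp: arborable_on_def\<close>)

text \<open>A vertex \<open>s\<close> isolated in its class cannot obstruct \<open>x\<close>: if
  \<open>x\<close> joins that class, \<open>s\<close> can be added after \<open>x\<close> as a
  vertex whose only possible neighbour in the class is \<open>x\<close>.\<close>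

lemma arborable_on_update_isolated:
  assumes c: "arborable_on c W" and W: "W \<subseteq> V" and x: "x \<notin> W" "a \<in> L x"
    and s: "s \<in> W" "\<And>v. v \<in> N s \<inter> W \<Longrightarrow> c v \<noteq> c s"
    and deg: "card {v \<in> N x \<inter> (W - {s}). c v = a} \<le> 1"
  shows "arborable_on (c(x := a)) (insert x W)"
proof (rule arborable_on_update_class[OF c x])
  let ?C = "{v\<in>W. c v = a} - {s}"
  have fin: "finite ?C" using finite_sub[OF W] by simp
  have C: "one_degenerate N (insert x ?C)"
  proof (rule one_degenerate_insert[OF _ fin irrefl])
    show "one_degenerate N ?C"
      using c by (auto simp: arborable_on_def intro: one_degenerate_mono)
    have "N x \<inter> ?C = {v \<in> N x \<inter> (W - {s}). c v = a}" by auto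
    then show "card (N x \<inter> ?C) \<le> 1" using deg by simp
  qed
  show "one_degenerate N (insert x {v\<in>W. c v = a})"
  proof (cases "c s = a")
    case True
    have "N s \<inter> insert x ?C \<subseteq> {x}" using s(2) True by auto
    then have "card (N s \<inter> insert x ?C) \<le> card {x}" by (intro card_mono) auto
    then have "one_degenerate N (insert s (insert x ?C))"
      using fin by (intro one_degenerate_insert[OF C] irrefl) auto
    moreover have "insert s (insert x ?C) = insert x {v\<in>W. c v = a}" using s(1) True by auto
    ultimately show ?thesis by simp
  next
    case False
    then have "?C = {v\<in>W. c v = a}" by auto
    then show ?thesis using C by simp
  qed
qed

lemma extension_update:
  assumes c: "extension m U D c" and V: "U \<subseteq> V" "D \<subseteq> V" "x \<in> V"
    and x: "x \<notin> U" "x \<notin> D" and a: "a \<in> L x" "a \<notin> c ` D"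
    and deg: "card {v \<in> N x \<inter> U. c v = a} \<le> 1"
  shows "extension m U (insert x D) (c(x := a))"
proof -
  \<comment> \<open>As \<open>a\<close> is fresh on \<open>D\<close>, only neighbours in
    \<open>U\<close> can share a class with \<open>x\<close>.\<close>
  have "{v \<in> N x \<inter> (U \<union> D). c v = a} = {v \<in> N x \<inter> U. c v = a}" using a by auto
  then have "arborable_on (c(x := a)) (insert x (U \<union> D))"
    using c V x a deg by (intro arborable_on_update) (auto simp: extension_def)
  moreover have "{v\<in>U. (c(x := a)) v = y} = {v\<in>U. c v = y}" for y using x by auto
  moreover have "inj_on (c(x := a)) (insert x D)"
    using c x a by (auto simp: extension_def inj_on_def)
  ultimately show ?thesis using c by (simp add: extension_def)
qed

text \<open>At least \<open>k - card D\<close> colours of \<open>L x\<close> are fresh on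
  \<open>D\<close>. Fewer than twice as many neighbours in \<open>U\<close> cannot repeat all of
  them.\<close>

lemma extension_insert:
  assumes c: "extension m U D c" and V: "U \<subseteq> V" "D \<subseteq> V" "x \<in> V"
    and x: "x \<notin> U" "x \<notin> D" and deg: "card (N x \<inter> U) < 2 * (k - card D)"
  shows "\<exists>c. extension m U (insert x D) c"
proof -
  have "finite D" using V finite_sub by auto
  then have "card (c ` D) \<le> card D" by (rule card_image_le)
  moreover have "card (L x) - card (c ` D) \<le> card (L x - c ` D)"
    using \<open>finite D\<close> by (intro diff_card_le_card_Diff) auto
  ultimately have "card (N x \<inter> U) < 2 * card (L x - c ` D)"
    using deg card_L[OF V(3)] by linarith
  then obtain a where "a \<in> L x - c ` D" "card {v \<in> N x \<inter> U. c v = a} \<le> 1"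
    using exists_rare_colour[of "L x - c ` D" "N x \<inter> U" c] finite_L[OF V(3)] finite_sub[OF V(1)]
    by (metis finite_Diff finite_Int)
  then show ?thesis using extension_update[OF c V x] by blast
qed

lemma extension_empty: "colourable U m \<Longrightarrow> \<exists>c. extension m U {} c"
  by (auto simp: colourable_def extension_def)

lemma extension_class_card:
  assumes c: "extension m U D c" and V: "U \<subseteq> V" "D \<subseteq> V"
  shows "card {v \<in> U \<union> D. c v = x} \<le> Suc m"
proof -
  have fin: "finite U" "finite D" using V finite_sub by auto
  have "{v \<in> U \<union> D. c v = x} = {v\<in>U. c v = x} \<union> {v\<in>D. c v = x}" by auto
  then have "card {v \<in> U \<union> D. c v = x} \<le> card {v\<in>U. c v = x} + card {v\<in>D. c v = x}"
    by (simp add: card_Un_le)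
  moreover have "card {v\<in>D. c v = x} \<le> 1"
    using c by (auto simp: extension_def inj_on_def card_le_Suc0_iff_eq fin)
  moreover have "card {v\<in>U. c v = x} \<le> m" using c by (simp add: extension_def)
  ultimately show ?thesis by linarith
qed

lemma extension_colourable:
  assumes c: "extension m U D c" and V: "U \<subseteq> V" "D \<subseteq> V"
  shows "colourable (U \<union> D) (Suc m)"
  using extension_class_card[OF assms] c by (auto simp: colourable_def extension_def)

text \<open>With \<open>U\<close> empty, an extension is a colouring with pairwise distinct colours,
  which lists of size \<open>k\<close> allow for up to \<open>k\<close> vertices.\<close>

lemma colourable_small:
  assumes "D \<subseteq> V" "card D \<le> k"
  shows "colourable D (Suc m)"
proof -
  have "finite D" using assms finite_sub by auto
  then have "D \<subseteq> V \<Longrightarrow> card D \<le> k \<Longrightarrow> \<exists>c. extension m {} D c"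
  proof (induction D rule: finite_induct)
    case empty
    show ?case by (rule extension_empty) (simp add: colourable_def arborable_on_def)
  next
    case (insert x D)
    then obtain c where "extension m {} D c" by auto
    then show ?case using insert by (intro extension_insert) auto
  qed
  then show ?thesis using extension_colourable[of m "{}" D] assms by auto
qed

text \<open>Greedy colouring: fewer than 2k coloured neighbours leave one of \<open>k\<close>
  colours occurring at most once among them.\<close>

lemma exists_arborable:
  assumes "W \<subseteq> V"
  shows "\<exists>c. arborable_on c W"
proof -
  have "finite W" using assms finite_sub by auto
  then show ?thesis using assms
  proof (induction W rule: finite_induct)
    case empty
    show ?case by (simp add: arborable_on_def)
  next
    case (insert x W)
    then obtain c where c: "arborable_on c W" by auto
    have "card (N x \<inter> W) < 2 * card (L x)"
      using deg_bound[of x] card_L[of x] card_nbrs_mono[of V W x] insert.prems by auto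
    then obtain a where "a \<in> L x" "card {v \<in> N x \<inter> W. c v = a} \<le> 1"
      using exists_rare_colour[of "L x" "N x \<inter> W" c] finite_L[of x] insert by auto
    then show ?case using arborable_on_update[OF c, of x a] insert by auto
  qed
qed


section \<open>Double counting, recolouring and the case of two colours per list\<close>

lemma sum_card_nbrs_commute:
  assumes "finite A" "finite B"
  shows "(\<Sum>a\<in>A. card (N a \<inter> B)) = (\<Sum>b\<in>B. card (N b \<inter> A))"
proof -
  have "(\<Sum>a\<in>A. card (N a \<inter> B)) = card (SIGMA a:A. N a \<inter> B)"
    using assms by (simp add: card_SigmaI)
  also have "\<dots> = card (SIGMA b:B. N b \<inter> A)"
    by (rule bij_betw_same_card[where f=prod.swap], rule bij_betw_byWitness[where f'=prod.swap])
      (auto dest: sym)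
  also have "\<dots> = (\<Sum>b\<in>B. card (N b \<inter> A))" using assms by (simp add: card_SigmaI)
  finally show ?thesis .
qed

text \<open>Neighbours of \<open>z\<close> that are isolated in class \<open>a\<close> merely become
  leaves attached to \<open>z\<close>. So only those with a neighbour of their own colour are
  counted.\<close>

lemma arborable_on_recolour:
  assumes c: "arborable_on c W" and W: "W \<subseteq> V" and z: "z \<in> W" "a \<in> L z" "c z \<noteq> a"
    and deg: "card (N z \<inter> {x\<in>W. c x = a \<and> (\<exists>y\<in>N x \<inter> W. c y = c x)}) \<le> 1"
  shows "arborable_on (c(z := a)) W"
  unfolding arborable_on_def
proof (intro conjI allI ballI)
  fix v assume "v \<in> W"
  then show "(c(z := a)) v \<in> L v" using c z by (auto simp: arborable_on_def)
next
  let ?A = "{x\<in>W. c x = a \<and> (\<exists>y\<in>N x \<inter> W. c y = c x)}"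
  have c': "one_degenerate N {v\<in>W. c v = y}" for y using c by (simp add: arborable_on_def)
  fix y
  show "one_degenerate N {v\<in>W. (c(z := a)) v = y}"
  proof (cases "y = a")
    case True
    have "\<exists>v\<in>T. card (N v \<inter> T) \<le> 1" if T: "T \<subseteq> {v\<in>W. (c(z := a)) v = a}" "T \<noteq> {}" for T
    proof -
      consider "z \<notin> T" | "z \<in> T" "card (N z \<inter> T) \<le> 1" | "z \<in> T" "\<not> N z \<inter> T \<subseteq> ?A"
      proof -
        have "finite (N z \<inter> ?A)" using finite_sub[OF W] by simp
        then have "card (N z \<inter> T) \<le> 1" if "N z \<inter> T \<subseteq> ?A"
          using deg that card_mono[of "N z \<inter> ?A" "N z \<inter> T"] by auto
        then show thesis using that by blast
      qed
      then show ?thesis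
      proof cases
        case 1
        then have "T \<subseteq> {v\<in>W. c v = a}" using T by (auto split: if_splits)
        then show ?thesis using c'[of a] T by (auto simp: one_degenerate_def)
      next
        case 2
        then show ?thesis by blast
      next
        \<comment> \<open>This neighbour of \<open>z\<close> was isolated in class \<open>a\<close>,
          so within \<open>T\<close> it is adjacent to \<open>z\<close> alone.\<close>
        case 3
        then obtain x where x: "x \<in> N z" "x \<in> T" "x \<notin> ?A" by blast
        moreover have "x \<noteq> z" using x irrefl by auto
        ultimately have "y = z" if "y \<in> N x \<inter> T" for y
          using that T(1) by (auto split: if_splits)
        then have "N x \<inter> T \<subseteq> {z}" by blast
        then have "card (N x \<inter> T) \<le> card {z}" by (intro card_mono) auto
        then show ?thesis using x by auto
      qed
    qed
    then show ?thesis using True by (auto simp: one_degenerate_def)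
  next
    case False
    then have "{v\<in>W. (c(z := a)) v = y} \<subseteq> {v\<in>W. c v = y}" by auto
    then show ?thesis using c' one_degenerate_mono by blast
  qed
qed

text \<open>A vertex of an overfull class that cannot move to its other list colour has two neighbours that
  each already have a neighbour of their own colour, hence at most two neighbours in the overfull
  class. Double counting then bounds the overfull class by its complement.\<close>

lemma exists_recolouring:
  assumes c: "arborable_on c W" and W: "W \<subseteq> V" and k: "k = 2"
    and big: "card W < 2 * card {v\<in>W. c v = b}"
  shows "\<exists>z\<in>W. \<exists>a. c z = b \<and> a \<noteq> b \<and> arborable_on (c(z := a)) W"
proof (rule ccontr)
  assume stuck: "\<not> ?thesis"
  let ?B = "{v\<in>W. c v = b}"
  let ?A = "{x \<in> W - ?B. \<exists>y\<in>N x \<inter> W. c y = c x}"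
  have fin: "finite W" by (rule finite_sub[OF W])
  have two: "2 \<le> card (N z \<inter> ?A)" if z: "z \<in> ?B" for z
  proof -
    have "card (L z) = 2" using card_L z W k by auto
    then obtain a where a: "a \<in> L z" "a \<noteq> b"
      using obtain_outside[of "{b}" "L z"] by auto
    let ?A' = "{x\<in>W. c x = a \<and> (\<exists>y\<in>N x \<inter> W. c y = c x)}"
    have "\<not> card (N z \<inter> ?A') \<le> 1"
      using arborable_on_recolour[OF c W, of z a] stuck z a by auto
    moreover have "card (N z \<inter> ?A') \<le> card (N z \<inter> ?A)"
      using fin a by (intro card_mono) auto
    ultimately show ?thesis by linarith
  qed
  have "card (N x \<inter> ?B) \<le> 2" if x: "x \<in> ?A" for x
  proof -
    obtain y where y: "y \<in> N x" "y \<in> W" "c y = c x" using x by auto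
    \<comment> \<open>\<open>y\<close> shares the colour of \<open>x\<close> and thus lies outside
      \<open>?B\<close>; it uses up one of the at most 2k - 1 = 3 neighbours of
      \<open>x\<close>.\<close>
    then have "card (N x \<inter> ?B) < card (N x \<inter> V)"
      using x W by (intro card_nbrs_less) auto
    then show ?thesis using deg_bound[of x] k x W by auto
  qed
  then have "(\<Sum>x\<in>?A. card (N x \<inter> ?B)) \<le> (\<Sum>x\<in>?A. 2)" by (rule sum_mono)
  moreover have "(\<Sum>z\<in>?B. 2) \<le> (\<Sum>z\<in>?B. card (N z \<inter> ?A))" using two by (rule sum_mono)
  moreover have "(\<Sum>z\<in>?B. card (N z \<inter> ?A)) = (\<Sum>x\<in>?A. card (N x \<inter> ?B))"
    by (rule sum_card_nbrs_commute) (use fin in auto)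
  ultimately have "card ?B \<le> card ?A" by simp
  also have "\<dots> \<le> card (W - ?B)" using fin by (intro card_mono) auto
  also have "\<dots> = card W - card ?B" using fin by (intro card_Diff_subset) auto
  finally show False using big by linarith
qed

text \<open>At most one class can have more than \<open>m\<close> of the at most 2m vertices. The
  induction is on its excess \<open>j\<close>. While it is overfull, every other class has fewer
  than \<open>m\<close> vertices and can receive one more.\<close>

lemma colourable_two:
  assumes W: "W \<subseteq> V" and k: "k = 2" and m: "card W \<le> 2 * m"
  shows "colourable W m"
proof -
  have fin: "finite W" by (rule finite_sub[OF W])
  have others: "card {v\<in>W. c v = x} + card {v\<in>W. c v = b} \<le> card W" if "x \<noteq> b"
    for c :: "'a \<Rightarrow> 'c" and x b
  proof -
    have "card {v\<in>W. c v = x} + card {v\<in>W. c v = b} = card ({v\<in>W. c v = x} \<union> {v\<in>W. c v = b})"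
      using fin that by (intro card_Un_disjoint[symmetric]) auto
    also have "\<dots> \<le> card W" using fin by (intro card_mono) auto
    finally show ?thesis .
  qed
  have balance: "colourable W m"
    if "arborable_on c W" "card {v\<in>W. c v = b} = m + j" "\<forall>x. x \<noteq> b \<longrightarrow> card {v\<in>W. c v = x} \<le> m"
    for c b j
    using that
  proof (induction j arbitrary: c)
    case 0
    then have "card {v\<in>W. c v = x} \<le> m" for x by (cases "x = b") auto
    then show ?case using 0 by (auto simp: colourable_def)
  next
    case (Suc j)
    then obtain z a where z: "z \<in> W" "c z = b" "a \<noteq> b" and c': "arborable_on (c(z := a)) W"
      using exists_recolouring[OF Suc.prems(1) W k, of b] m by auto
    let ?c = "c(z := a)"
    have "{v\<in>W. ?c v = b} = {v\<in>W. c v = b} - {z}" using z by auto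
    then have b: "card {v\<in>W. ?c v = b} = m + j" using Suc.prems z fin by simp
    have "card {v\<in>W. ?c v = x} \<le> m" if "x \<noteq> b" for x
    proof (cases "x = a")
      case True
      have "{v\<in>W. ?c v = a} = insert z {v\<in>W. c v = a}" using z by auto
      then have "card {v\<in>W. ?c v = a} \<le> Suc (card {v\<in>W. c v = a})"
        by (simp add: card_insert_le_m1 card_insert_if fin)
      then show ?thesis using others[OF z(3), of c] Suc.prems(2) m True by simp
    next
      case False
      then have "{v\<in>W. ?c v = x} = {v\<in>W. c v = x}" using z that by auto
      then show ?thesis using Suc.prems that by simp
    qed
    then show ?case using Suc.IH[OF c' b] by blast
  qed
  obtain c where c: "arborable_on c W" using exists_arborable[OF W] by blast
  show ?thesis
  proof (cases "\<forall>x. card {v\<in>W. c v = x} \<le> m")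
    case True
    then show ?thesis using c by (auto simp: colourable_def)
  next
    case False
    then obtain b where b: "m < card {v\<in>W. c v = b}" by (auto simp: not_le)
    then have "card {v\<in>W. c v = b} = m + (card {v\<in>W. c v = b} - m)" by simp
    then show ?thesis using balance[OF c] others[of _ b c] b m by fastforce
  qed
qed

end

section \<open>Sparse graphs and the case of at least three colours per list\<close>

locale sparse_list_assigned_graph = list_assigned_graph V N L k
  for V :: "'a set" and N :: "'a \<Rightarrow> 'a set" and L :: "'a \<Rightarrow> 'c set" and k :: nat +
  assumes sparse: "W \<subseteq> V \<Longrightarrow> W \<noteq> {} \<Longrightarrow> (\<Sum>v\<in>W. card (N v \<inter> W)) + 4 \<le> 4 * card W"
begin

lemma exists_low_degree:
  assumes "W \<subseteq> V" "W \<noteq> {}"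
  shows "\<exists>v\<in>W. card (N v \<inter> W) \<le> 3"
proof (rule ccontr)
  assume "\<not> ?thesis"
  then have "(\<Sum>v\<in>W. 4) \<le> (\<Sum>v\<in>W. card (N v \<inter> W))"
    by (intro sum_mono) (simp add: not_le Suc_le_eq[symmetric])
  then show False using sparse[OF assms] by simp
qed

text \<open>\<open>F\<close> is fixed before any colouring is known and must be addable after every
  coloured \<open>D\<close> outside \<open>T\<close>. The strict inequality leaves at least two
  fresh colours for each vertex of \<open>F\<close> in turn and one for a last vertex after
  them.\<close>

definition filling :: "'a set \<Rightarrow> 'a set \<Rightarrow> bool" where
  "filling T F \<longleftrightarrow> F \<subseteq> T \<and>
     (\<forall>m U D c. U \<subseteq> T - F \<longrightarrow> D \<subseteq> V - T \<longrightarrow> card D + card F < k \<longrightarrow> extension m U D c \<longrightarrow>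
       (\<exists>c'. extension m U (D \<union> F) c'))"

lemma filling_extension:
  assumes "filling T F" "U \<subseteq> T - F" "D \<subseteq> V - T" "card D + card F < k" "extension m U D c"
  obtains c' where "extension m U (D \<union> F) c'"
  using assms unfolding filling_def by metis

text \<open>A vertex \<open>f\<close> of degree at most 3 in \<open>T\<close> is coloured first; it
  then counts as part of \<open>D\<close>, and the rest of the filling is found in
  \<open>T - {f}\<close>.\<close>

lemma exists_filling:
  assumes "T \<subseteq> V" "r \<le> card T"
  shows "\<exists>F. filling T F \<and> card F = r"
  using assms
proof (induction r arbitrary: T)
  case 0
  show ?case by (rule exI[of _ "{}"]) (auto simp: filling_def)
next
  case (Suc r)
  have fin: "finite T" using Suc.prems finite_sub by blast
  obtain f where f: "f \<in> T" "card (N f \<inter> T) \<le> 3"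
    using exists_low_degree[of T] Suc.prems by force
  have "T - {f} \<subseteq> V" "r \<le> card (T - {f})" using Suc.prems f fin by auto
  then obtain F where fill: "filling (T - {f}) F" and F: "card F = r"
    using Suc.IH by blast
  have sub: "F \<subseteq> T - {f}" using fill by (simp add: filling_def)
  then have card: "card (insert f F) = Suc r"
    using F fin by (subst card_insert_disjoint) (auto dest: finite_subset)
  have "\<exists>c'. extension m U (D \<union> insert f F) c'"
    if U: "U \<subseteq> T - insert f F" and D: "D \<subseteq> V - T" "card D + card (insert f F) < k"
      and c: "extension m U D c" for m U D c
  proof -
    have "card (N f \<inter> U) \<le> card (N f \<inter> T)" using U Suc.prems by (intro card_nbrs_mono) auto
    \<comment> \<open>At least two colours are fresh, and 3 < 2 * 2.\<close>
    then have "card (N f \<inter> U) < 2 * (k - card D)" using f D card by linarith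
    moreover have "U \<subseteq> V" "D \<subseteq> V" "f \<in> V" "f \<notin> U" "f \<notin> D" using U D Suc.prems f by auto
    ultimately obtain c1 where c1: "extension m U (insert f D) c1"
      using extension_insert[OF c] by blast
    have "card (insert f D) \<le> Suc (card D)"
      by (simp add: card_insert_le_m1)
    then have "card (insert f D) + card F < k" using D card F by linarith
    moreover have "U \<subseteq> T - {f} - F" "insert f D \<subseteq> V - (T - {f})"
      using U D f Suc.prems by auto
    ultimately obtain c2 where "extension m U (insert f D \<union> F) c2"
      using filling_extension[OF fill] c1 by metis
    then show ?thesis by auto
  qed
  then have "filling T (insert f F)" using sub f by (auto simp: filling_def)
  then show ?case using card by blast
qed

text \<open>The \<open>k\<close> removed vertices return in three stages: \<open>D\<close> by
  \<open>start\<close>, then a filling \<open>F\<close>, finally \<open>v\<close>. One colour is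
  surely left for \<open>v\<close>, which suffices because \<open>D\<close> was chosen so that at
  most one neighbour of \<open>v\<close> remains.\<close>

lemma colourable_reduce:
  assumes IH: "\<And>U. U \<subseteq> V \<Longrightarrow> card U \<le> m * k \<Longrightarrow> colourable U m"
    and W: "W \<subseteq> V" "k \<le> card W" "card W \<le> Suc m * k"
    and v: "v \<in> W" "card (N v \<inter> (W - D)) \<le> 1"
    and D: "D \<subseteq> W - {v}" "card D < k"
    and start: "\<And>U. U \<subseteq> W - D - {v} \<Longrightarrow> colourable U m \<Longrightarrow> \<exists>c. extension m U D c"
  shows "colourable W (Suc m)"
proof -
  have DV: "D \<subseteq> V" using D(1) W(1) by auto
  have fin: "finite W" "finite D" using finite_sub[OF W(1)] finite_sub[OF DV] by auto
  \<comment> \<open>Together with \<open>D\<close> and \<open>v\<close>, a filling of this size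
    makes exactly \<open>k\<close> removed vertices.\<close>
  define r where "r = k - 1 - card D"
  define T where "T = W - D - {v}"
  have T: "T \<subseteq> V" "T \<subseteq> W" using W by (auto simp: T_def)
  have "D \<subseteq> W" "v \<in> W - D" using D v by auto
  then have "card T = card W - card D - 1"
    using fin by (simp add: T_def card_Diff_subset)
  then have "r \<le> card T" using W(2) by (simp add: r_def)
  then obtain F where fill: "filling T F" and "card F = r"
    using exists_filling[OF T(1)] by blast
  then have F: "F \<subseteq> T" "card F = r" by (auto simp: filling_def)
  have finF: "finite F" using finite_sub[OF subset_trans[OF F(1) T(1)]] .
  define U where "U = T - F"
  have disj: "D \<inter> F = {}" "v \<notin> D \<union> F" using D(1) F(1) by (auto simp: T_def)
  have S: "insert v (D \<union> F) \<subseteq> W" using v(1) D(1) F(1) T(2) by auto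
  have U: "U = W - insert v (D \<union> F)" by (auto simp: U_def T_def)
  have V: "U \<subseteq> V" "D \<union> F \<subseteq> V" "v \<in> V" "v \<notin> U" "D \<subseteq> V - T"
    using S W(1) U D(1) by (auto simp: T_def)
  have DF: "card (D \<union> F) = k - 1"
    using card_Un_disjoint[OF fin(2) finF disj(1)] F(2) D(2) by (simp add: r_def)
  then have "card (insert v (D \<union> F)) = k"
    using card_insert_disjoint[of "D \<union> F" v] disj(2) fin(2) finF D(2) by simp
  then have "card U = card W - k"
    using card_Diff_subset[OF _ S] fin(2) finF U by simp
  then have "colourable U m" using IH[OF V(1)] W(3) by simp
  moreover have "U \<subseteq> W - D - {v}" using U by auto
  ultimately obtain c where c: "extension m U D c" using start[of U] by metis
  have "card D + card F < k" using D(2) F(2) by (simp add: r_def)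
  then obtain c where c: "extension m U (D \<union> F) c"
    using filling_extension[OF fill equalityD1[OF U_def] V(5) _ c] by metis
  have "card (N v \<inter> U) \<le> card (N v \<inter> (W - D))"
    using U W(1) by (intro card_nbrs_mono) auto
  then have "card (N v \<inter> U) < 2 * (k - card (D \<union> F))" using DF D(2) v(2) by simp
  then obtain c where c: "extension m U (insert v (D \<union> F)) c"
    using extension_insert[OF c V(1,2,3,4) disj(2)] by metis
  have "U \<union> insert v (D \<union> F) = W" using S U by auto
  then show ?thesis using extension_colourable[OF c V(1)] V(2,3) by simp
qed

text \<open>Removing one neighbour \<open>u\<close> of \<open>v\<close>, or any other vertex if
  \<open>v\<close> has none, leaves \<open>v\<close> at most one neighbour. Being coloured first,
  \<open>u\<close> has all \<open>k\<close> colours against at most 2k - 1 neighbours.\<close>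

lemma colourable_degree_le_2:
  assumes IH: "\<And>U. U \<subseteq> V \<Longrightarrow> card U \<le> m * k \<Longrightarrow> colourable U m"
    and W: "W \<subseteq> V" "k \<le> card W" "card W \<le> Suc m * k" and k: "2 \<le> k"
    and v: "v \<in> W" "card (N v \<inter> W) \<le> 2"
  shows "colourable W (Suc m)"
proof -
  have fin: "finite W" by (rule finite_sub[OF W(1)])
  obtain u where u: "u \<in> W" "u \<noteq> v" "card (N v \<inter> (W - {u})) \<le> 1"
  proof (cases "N v \<inter> W = {}")
    case True
    then have "N v \<inter> (W - {u}) = {}" for u by auto
    moreover obtain u where "u \<in> W" "u \<notin> {v}"
      using obtain_outside[of "{v}" W] W k by auto
    ultimately show thesis using that[of u] by auto
  next
    case False
    then obtain u where u: "u \<in> N v" "u \<in> W" by auto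
    have "card (N v \<inter> (W - {u})) < card (N v \<inter> W)" using u W by (intro card_nbrs_less) auto
    then show thesis using that[of u] u v irrefl by auto
  qed
  show ?thesis
  proof (rule colourable_reduce[OF IH W v(1) u(3)])
    fix U assume U: "U \<subseteq> W - {u} - {v}" "colourable U m"
    then obtain c where "extension m U {} c" using extension_empty by blast
    moreover have V: "U \<subseteq> V" "u \<in> V" "u \<notin> U" using U(1) W(1) u(2) u(1) by auto
    moreover have "card (N u \<inter> U) < 2 * (k - card {})"
      using card_nbrs_mono[OF order_refl V(1), of u] deg_bound[OF V(2)] by simp
    ultimately show "\<exists>c. extension m U {u} c"
      by (intro extension_insert) auto
  qed (use u k in auto)
qed

text \<open>Two neighbours \<open>u\<close> and \<open>w\<close> are removed with \<open>v\<close>.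
  First \<open>u\<close> chooses from all \<open>k\<close> colours. Then \<open>w\<close> has at
  least \<open>k - 1\<close>, against at most 2k - 3 kept neighbours, since its neighbour
  \<open>v\<close> is gone as well.\<close>

lemma colourable_degree_3:
  assumes IH: "\<And>U. U \<subseteq> V \<Longrightarrow> card U \<le> m * k \<Longrightarrow> colourable U m"
    and W: "W \<subseteq> V" "k \<le> card W" "card W \<le> Suc m * k" and k: "3 \<le> k"
    and v: "v \<in> W" "card (N v \<inter> W) = 3"
    and w: "w \<in> N v" "w \<in> W" "card (N w \<inter> W) \<le> 2 * k - 2"
  shows "colourable W (Suc m)"
proof -
  obtain u where u: "u \<in> N v" "u \<in> W" "u \<noteq> w"
    using obtain_outside[of "{w}" "N v \<inter> W"] v by auto
  have "card (N v \<inter> (W - {u})) < card (N v \<inter> W)" using u W by (intro card_nbrs_less) auto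
  moreover have "card (N v \<inter> (W - {w,u})) < card (N v \<inter> (W - {u}))"
    using u w W by (intro card_nbrs_less[of _ _ w]) auto
  ultimately have v1: "card (N v \<inter> (W - {w,u})) \<le> 1" using v by linarith
  show ?thesis
  proof (rule colourable_reduce[OF IH W v(1) v1])
    show "{w,u} \<subseteq> W - {v}" using u w irrefl[of v] by auto
    fix U assume U: "U \<subseteq> W - {w,u} - {v}" "colourable U m"
    then obtain c where "extension m U {} c" using extension_empty by blast
    moreover have V: "U \<subseteq> V" "u \<in> V" "u \<notin> U" using U(1) W(1) u(2) u(1) by auto
    moreover have "card (N u \<inter> U) < 2 * (k - card {})"
      using card_nbrs_mono[OF order_refl V(1), of u] deg_bound[OF V(2)] by simp
    ultimately have "\<exists>c. extension m U {u} c"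
      by (intro extension_insert) auto
    then obtain c where c: "extension m U {u} c" by blast
    have "card (N w \<inter> U) < card (N w \<inter> W)"
      using U(1) W(1) v(1) w(1) sym by (intro card_nbrs_less[of _ _ v]) auto
    then have "card (N w \<inter> U) < 2 * (k - card {u})" using w(3) k by auto
    moreover have "w \<in> V" "w \<notin> U" "w \<notin> {u}" "{u} \<subseteq> V" using U(1) W(1) u w(2) by auto
    ultimately show "\<exists>c. extension m U {w,u} c"
      using extension_insert[OF c V(1)] by blast
  next
    show "card {w,u} < k" using u(3) k by simp
  qed
qed

text \<open>Besides \<open>u\<close> and \<open>v1, v2, v3\<close>, remove a further neighbour \<open>y\<close> of \<open>v1\<close> and \<open>w\<close> of \<open>v2\<close>. First \<open>w, v2, v3\<close> are
  coloured so that one of \<open>v2, v3\<close> is isolated in its class. That vertex does not restrict the colour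
  of \<open>u\<close>, whose three other coloured neighbours exclude at most one colour. Thus \<open>u\<close> has two
  admissible colours, \<open>y\<close> has at least one, and \<open>v1\<close> accepts whatever is left.\<close>

lemma colourable_hub:
  assumes IH: "\<And>U. U \<subseteq> V \<Longrightarrow> card U \<le> m * 3 \<Longrightarrow> colourable U m"
    and W: "W \<subseteq> V" "card W \<le> Suc (Suc m) * 3" and k: "k = 3"
    and u: "u \<in> W" and nb: "{v1,v2,v3} \<subseteq> N u \<inter> W" and dist: "v1 \<noteq> v2" "v1 \<noteq> v3" "v2 \<noteq> v3"
    and deg: "\<And>v. v \<in> {v1,v2,v3} \<Longrightarrow> card (N v \<inter> W) = 3"
    and far: "\<And>v x. v \<in> {v1,v2,v3} \<Longrightarrow> x \<in> N v \<inter> W \<Longrightarrow> card (N x \<inter> W) \<noteq> 3"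
  shows "colourable W (Suc (Suc m))"
proof -
  have fin: "finite W" by (rule finite_sub[OF W(1)])
  have un: "u \<in> N v1" "u \<in> N v2" "u \<in> N v3" using nb sym by auto
  obtain y where y: "y \<in> N v1" "y \<in> W" "y \<noteq> u"
    using obtain_outside[of "{u}" "N v1 \<inter> W"] deg[of v1] by auto
  obtain w where w: "w \<in> N v2" "w \<in> W" "w \<noteq> u" "w \<noteq> y"
    using obtain_third[of "N v2 \<inter> W" u y] deg[of v2] by auto
  \<comment> \<open>Each of \<open>u\<close>, \<open>y\<close>, \<open>w\<close> is adjacent to a
    vertex of degree 3 among the \<open>v1, v2, v3\<close>, so by \<open>far\<close> it does not
    have degree 3 itself.\<close>
  have ne: "u \<notin> {v1,v2,v3}" "y \<notin> {v1,v2,v3}" "w \<notin> {v1,v2,v3}"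
    using deg far[of v1 u] far[of v1 y] far[of v2 w] un y(1,2) w(1,2) u by auto
  define U where "U = W - {u,v1,y,v2,v3,w}"
  have UV: "U \<subseteq> V" using W by (auto simp: U_def)
  have finU: "finite U" by (rule finite_sub[OF UV])
  have "card {u,v1,y,v2,v3,w} = 6" using ne dist y(3) w(3,4) by (auto simp: card_insert_if)
  moreover have "card U = card W - card {u,v1,y,v2,v3,w}"
    unfolding U_def using nb u y w by (intro card_Diff_subset) auto
  ultimately have "card U \<le> m * 3" using W(2) by simp
  then obtain c0 where c0: "extension m U {} c0" using extension_empty IH[OF UV] by blast
  have inV: "u \<in> V" "y \<in> V" "w \<in> V" "v1 \<in> V" "v2 \<in> V" "v3 \<in> V" using W(1) u y w nb by auto
  have notU: "u \<notin> U" "y \<notin> U" "w \<notin> U" "v1 \<notin> U" "v2 \<notin> U" "v3 \<notin> U" by (auto simp: U_def)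
  have L3: "card (L v) = 3" if "v \<in> V" for v using card_L[OF that] k by simp
  have deg5: "card (N v \<inter> W) \<le> 5" if "v \<in> V" for v
    using deg_bound[OF that] card_nbrs_mono[OF order_refl W(1), of v] k by simp
  have "card (N w \<inter> U) < 2 * (k - card {})"
    using card_nbrs_mono[OF order_refl UV, of w] deg_bound[OF inV(3)] by simp
  then obtain c1 where c1: "extension m U {w} c1"
    using extension_insert[OF c0 UV _ inV(3) notU(3)] by auto
  have "card (N v2 \<inter> (W - {u})) < card (N v2 \<inter> W)"
    using un u W by (intro card_nbrs_less) auto
  moreover have "card (N v2 \<inter> U) < card (N v2 \<inter> (W - {u}))"
    using w W by (intro card_nbrs_less[of _ _ w]) (auto simp: U_def)
  ultimately have deg2: "card (N v2 \<inter> U) \<le> 1" using deg[of v2] by simp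
  have "card (N v3 \<inter> U) < card (N v3 \<inter> W)"
    using un u W by (intro card_nbrs_less[of _ _ u]) (auto simp: U_def)
  then have deg3: "card (N v3 \<inter> U) \<le> 2" using deg[of v3] by simp
  have deg2': "card {x \<in> N v2 \<inter> U. c x = a} \<le> 1" for c :: "'a \<Rightarrow> 'c" and a
  proof -
    have "card {x \<in> N v2 \<inter> U. c x = a} \<le> card (N v2 \<inter> U)" using finU by (intro card_mono) auto
    then show ?thesis using deg2 by linarith
  qed
  define D where "D = {w,v2,v3}"
  have "\<exists>c s. extension m U D c \<and> s \<in> {v2,v3} \<and> (\<forall>x \<in> N s \<inter> U. c x \<noteq> c s)"
  proof -
    have "card (insert (c1 w) (c1 ` (N v2 \<inter> U))) \<le> Suc (card (c1 ` (N v2 \<inter> U)))"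
      by (simp add: card_insert_le_m1)
    also have "\<dots> \<le> Suc (card (N v2 \<inter> U))" using finU by (simp add: card_image_le)
    finally have "card (insert (c1 w) (c1 ` (N v2 \<inter> U))) < card (L v2)"
      using deg2 L3[OF inV(5)] by simp
    then obtain e where e: "e \<in> L v2" "e \<noteq> c1 w" "e \<notin> c1 ` (N v2 \<inter> U)"
      using obtain_outside[of "insert (c1 w) (c1 ` (N v2 \<inter> U))" "L v2"] finU by auto
    obtain g where g: "g \<in> L v3" "g \<noteq> c1 w" "g \<noteq> e" by (rule obtain_third[OF L3[OF inV(6)]])
    show ?thesis
    \<comment> \<open>If \<open>g\<close> is admissible at \<open>v3\<close>, then \<open>e\<close>
      isolates \<open>v2\<close>. Otherwise \<open>v3\<close> has exactly two neighbours in
      \<open>U\<close>, both coloured \<open>g\<close>, and any other colour isolates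
      \<open>v3\<close>.\<close>
    proof (cases "card {x \<in> N v3 \<inter> U. c1 x = g} \<le> 1")
      case True
      have c2: "extension m U {v2,w} (c1(v2 := e))"
        using e ne inV by (intro extension_update[OF c1 UV _ inV(5) notU(5) _ _ _ deg2']) auto
      have "{x \<in> N v3 \<inter> U. (c1(v2 := e)) x = g} = {x \<in> N v3 \<inter> U. c1 x = g}"
        using notU by auto
      then have "extension m U {v3,v2,w} (c1(v2 := e, v3 := g))"
        using g ne inV dist True by (intro extension_update[OF c2 UV _ inV(6) notU(6)]) auto
      moreover have "{v3,v2,w} = D" by (auto simp: D_def)
      moreover have "\<forall>x \<in> N v2 \<inter> U. (c1(v2 := e, v3 := g)) x \<noteq> (c1(v2 := e, v3 := g)) v2"
        using e(3) notU dist by auto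
      ultimately show ?thesis by (intro exI[of _ "c1(v2 := e, v3 := g)"] exI[of _ v2]) simp
    next
      case False
      have "{x \<in> N v3 \<inter> U. c1 x = g} = N v3 \<inter> U"
        using False deg3 finU by (intro card_seteq) auto
      then have g_all: "\<And>x. x \<in> N v3 \<inter> U \<Longrightarrow> c1 x = g" by auto
      obtain h where h: "h \<in> L v3" "h \<noteq> c1 w" "h \<noteq> g" by (rule obtain_third[OF L3[OF inV(6)]])
      obtain f where f: "f \<in> L v2" "f \<noteq> c1 w" "f \<noteq> h" by (rule obtain_third[OF L3[OF inV(5)]])
      have "{x \<in> N v3 \<inter> U. c1 x = h} = {}" using g_all h by auto
      then have "card {x \<in> N v3 \<inter> U. c1 x = h} \<le> 1" by (simp only: card.empty)
      then have c2: "extension m U {v3,w} (c1(v3 := h))"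
        using h ne inV by (intro extension_update[OF c1 UV _ inV(6) notU(6)]) auto
      have "extension m U {v2,v3,w} (c1(v3 := h, v2 := f))"
        using f ne inV dist
        by (intro extension_update[OF c2 UV _ inV(5) notU(5) _ _ _ deg2']) auto
      moreover have "{v2,v3,w} = D" by (auto simp: D_def)
      moreover have "\<forall>x \<in> N v3 \<inter> U. (c1(v3 := h, v2 := f)) x \<noteq> (c1(v3 := h, v2 := f)) v3"
        using g_all h notU dist by auto
      ultimately show ?thesis by (intro exI[of _ "c1(v3 := h, v2 := f)"] exI[of _ v3]) simp
    qed
  qed
  then obtain c s where c: "extension m U D c" and s: "s \<in> {v2,v3}"
    and sU: "\<And>x. x \<in> N s \<inter> U \<Longrightarrow> c x \<noteq> c s" by blast
  \<comment> \<open>The six vertices return in two rounds of three. After the first,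
    \<open>U1\<close> is the kept set of the second, with class bound \<open>m + 1\<close>.\<close>
  define U1 where "U1 = U \<union> D"
  have DV: "D \<subseteq> V" using inV by (simp add: D_def)
  have U1: "U1 \<subseteq> V" "U1 \<subseteq> W" using UV DV nb w by (auto simp: U1_def U_def D_def)
  have notU1: "u \<notin> U1" "y \<notin> U1" "v1 \<notin> U1"
    using ne dist w y notU by (auto simp: U1_def D_def)
  have arb: "arborable_on c U1" and cls: "\<And>x. card {v\<in>U1. c v = x} \<le> Suc m"
    using c extension_class_card[OF c UV DV] by (auto simp: U1_def extension_def)
  have sD: "s \<in> D" using s by (auto simp: D_def)
  have s_iso: "c x \<noteq> c s" if "x \<in> N s \<inter> U1" for x
    using that sU[of x] c sD irrefl[of s] by (auto simp: U1_def extension_def inj_on_def)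
  have "card (N u \<inter> U1) < card (N u \<inter> W)"
    using nb W(1) U1 notU1 by (intro card_nbrs_less[of _ _ v1]) auto
  moreover have "card (N u \<inter> (U1 - {s})) < card (N u \<inter> U1)"
    using nb s sD U1 by (intro card_nbrs_less[of _ _ s]) (auto simp: U1_def)
  ultimately have "card (N u \<inter> (U1 - {s})) < 2 * 2" using deg5[OF inV(1)] by linarith
  then have G: "1 < card {a \<in> L u. card {x \<in> N u \<inter> (U1 - {s}). c x = a} \<le> 1}"
    using few_repetitions_card[OF finite_L[OF inV(1)], of "N u \<inter> (U1 - {s})" 2 c]
      finite_sub[OF U1(1)] L3[OF inV(1)] by simp
  have "card (N y \<inter> U1) < 2 * card (L y)"
    using card_nbrs_mono[OF order_refl U1(1), of y] deg_bound[OF inV(2)] card_L[OF inV(2)] by simp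
  then obtain b where b: "b \<in> L y" "card {x \<in> N y \<inter> U1. c x = b} \<le> 1"
    using exists_rare_colour[OF finite_L[OF inV(2)], of "N y \<inter> U1" c] finite_sub[OF U1(1)]
    by blast
  obtain a where a: "a \<in> L u" "card {x \<in> N u \<inter> (U1 - {s}). c x = a} \<le> 1" "a \<noteq> b"
    using obtain_outside[of "{b}" "{a \<in> L u. card {x \<in> N u \<inter> (U1 - {s}). c x = a} \<le> 1}"] G
    by auto
  have "arborable_on (c(u := a)) (insert u U1)"
    using sD by (intro arborable_on_update_isolated[OF arb U1(1) notU1(1) a(1) _ s_iso a(2)])
      (auto simp: U1_def)
  moreover have "{v\<in>U1. (c(u := a)) v = x} = {v\<in>U1. c v = x}" for x using notU1 by auto
  ultimately have cu: "extension (Suc m) U1 {u} (c(u := a))"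
    using cls by (simp add: extension_def)
  have "{x \<in> N y \<inter> U1. (c(u := a)) x = b} = {x \<in> N y \<inter> U1. c x = b}" using notU1 by auto
  then have cy: "extension (Suc m) U1 {y,u} (c(u := a, y := b))"
    using a b y inV by (intro extension_update[OF cu U1(1) _ inV(2) notU1(2)]) auto
  have "card (N v1 \<inter> (W - {u})) < card (N v1 \<inter> W)"
    using un u W by (intro card_nbrs_less) auto
  moreover have "card (N v1 \<inter> U1) < card (N v1 \<inter> (W - {u}))"
    using y W U1 notU1 by (intro card_nbrs_less[of _ _ y]) auto
  ultimately have "card (N v1 \<inter> U1) < 2 * (k - card {y,u})" using deg[of v1] k y by simp
  then obtain c' where c': "extension (Suc m) U1 {v1,y,u} c'"
    using extension_insert[OF cy U1(1) _ inV(4) notU1(3)] ne inV by auto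
  have "U1 \<union> {v1,y,u} = W" using nb u y w by (auto simp: U1_def U_def D_def)
  then show ?thesis using extension_colourable[OF c' U1(1)] inV by simp
qed

text \<open>Discharging: every neighbour of a vertex of degree 3 has degree 2k - 1. Without a hub,
  the excesses 2k - 5 of these vertices over degree 4 make up for the deficit 1 of each vertex of
  degree 3, so the degree sum reaches \<open>4 * card W\<close>, against
  \<open>sparse\<close>.\<close>

lemma exists_hub:
  assumes W: "W \<subseteq> V" "W \<noteq> {}" and k: "3 \<le> k"
    and deg3: "\<And>v. v \<in> W \<Longrightarrow> 3 \<le> card (N v \<inter> W)"
    and far: "\<And>v w. v \<in> W \<Longrightarrow> card (N v \<inter> W) = 3 \<Longrightarrow> w \<in> N v \<Longrightarrow> w \<in> W \<Longrightarrow>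
      2 * k - 2 < card (N w \<inter> W)"
  shows "k = 3 \<and> (\<exists>u\<in>W. 3 \<le> card (N u \<inter> {v\<in>W. card (N v \<inter> W) = 3}))"
proof (rule ccontr)
  assume contr: "\<not> ?thesis"
  let ?d = "\<lambda>v. card (N v \<inter> W)"
  let ?T = "{v\<in>W. ?d v = 3}" and ?B = "{v\<in>W. ?d v = 2 * k - 1}"
  have fin: "finite W" by (rule finite_sub[OF W(1)])
  have dmax: "?d v \<le> 2 * k - 1" if "v \<in> W" for v
    using deg_bound[of v] card_nbrs_mono[OF order_refl W(1), of v] that W(1) by fastforce
  have NB: "N v \<inter> W = N v \<inter> ?B" if "v \<in> ?T" for v
  proof -
    have "?d w = 2 * k - 1" if "w \<in> N v" "w \<in> W" for w
      using far[of v w] dmax[of w] that \<open>v \<in> ?T\<close> by simp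
    then show ?thesis by auto
  qed
  have "3 * card ?T = (\<Sum>v\<in>?T. ?d v)" by simp
  also have "\<dots> = (\<Sum>v\<in>?T. card (N v \<inter> ?B))" using NB by (intro sum.cong) simp_all
  also have "\<dots> = (\<Sum>u\<in>?B. card (N u \<inter> ?T))" by (rule sum_card_nbrs_commute) (use fin in auto)
  also have "\<dots> \<le> (\<Sum>u\<in>?B. 3 * (2 * k - 5))"
  proof (rule sum_mono)
    fix u assume u: "u \<in> ?B"
    show "card (N u \<inter> ?T) \<le> 3 * (2 * k - 5)"
    \<comment> \<open>For \<open>k = 3\<close> the bound is 3, and the absence of a hub gives fewer;
      for larger \<open>k\<close>, already 2k - 1 \<le> 3(2k - 5).\<close>
    proof (cases "k = 3")
      case True
      then show ?thesis using contr u by auto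
    next
      case False
      have "card (N u \<inter> ?T) \<le> 2 * k - 1"
        using card_nbrs_mono[OF W(1), of ?T u] u by auto
      then show ?thesis using False k by linarith
    qed
  qed
  also have "\<dots> = 3 * (card ?B * (2 * k - 5))" by simp
  finally have TB: "card ?T \<le> card ?B * (2 * k - 5)" by linarith
  have "(\<Sum>v\<in>W. 4 + (if v \<in> ?B then 2 * k - 5 else 0)) \<le> (\<Sum>v\<in>W. ?d v + (if v \<in> ?T then 1 else 0))"
  proof (rule sum_mono)
    fix v assume "v \<in> W"
    then show "4 + (if v \<in> ?B then 2 * k - 5 else 0) \<le> ?d v + (if v \<in> ?T then 1 else 0)"
      using deg3[of v] k by auto
  qed
  moreover have "(\<Sum>v\<in>W. if v \<in> ?B then 2 * k - 5 else 0) = card ?B * (2 * k - 5)"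
    using fin by (subst sum.inter_restrict[symmetric]) (auto simp: Int_def)
  moreover have "(\<Sum>v\<in>W. if v \<in> ?T then 1 else 0) = card ?T"
    using fin by (subst sum.inter_restrict[symmetric]) (auto simp: Int_def)
  ultimately have "4 * card W + card ?B * (2 * k - 5) \<le> (\<Sum>v\<in>W. ?d v) + card ?T"
    by (simp only: sum.distrib) simp
  then show False using TB sparse[OF W] by linarith
qed

text \<open>The induction is strong because a hub removes six vertices at once and falls back on
  \<open>m - 2\<close>.\<close>

lemma colourable_ge_three:
  assumes k: "3 \<le> k"
  shows "W \<subseteq> V \<Longrightarrow> card W \<le> m * k \<Longrightarrow> colourable W m"
proof (induction m arbitrary: W rule: less_induct)
  case (less m)
  have fin: "finite W" by (rule finite_sub[OF less.prems(1)])
  show ?case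
  proof (cases m)
    case 0
    then have "W = {}" using less.prems fin by simp
    then show ?thesis by (simp add: colourable_def arborable_on_def)
  next
    case (Suc n)
    have IH: "\<And>U. U \<subseteq> V \<Longrightarrow> card U \<le> n * k \<Longrightarrow> colourable U n"
      using less.IH[of n] Suc by simp
    have cardW: "card W \<le> Suc n * k" using less.prems(2) Suc by simp
    show ?thesis
    proof (cases "card W \<le> k")
      case True
      then show ?thesis using colourable_small less.prems(1) Suc by simp
    next
      case False
      then have big: "k \<le> card W" by simp
      consider v where "v \<in> W" "card (N v \<inter> W) \<le> 2"
        | v w where "v \<in> W" "card (N v \<inter> W) = 3" "w \<in> N v" "w \<in> W" "card (N w \<inter> W) \<le> 2 * k - 2"
        | "\<And>v. v \<in> W \<Longrightarrow> 3 \<le> card (N v \<inter> W)"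
          "\<And>v w. v \<in> W \<Longrightarrow> card (N v \<inter> W) = 3 \<Longrightarrow> w \<in> N v \<Longrightarrow> w \<in> W \<Longrightarrow>
            2 * k - 2 < card (N w \<inter> W)"
        by (metis not_less_eq_eq numeral_2_eq_2 numeral_3_eq_3 not_le)
      then show ?thesis
      proof cases
        case 1
        then show ?thesis
          using colourable_degree_le_2[OF IH less.prems(1) big cardW] k Suc by simp
      next
        case 2
        then show ?thesis
          using colourable_degree_3[OF IH less.prems(1) big cardW k] Suc by simp
      next
        case 3
        have "W \<noteq> {}" using False by auto
        then have "k = 3 \<and> (\<exists>u\<in>W. 3 \<le> card (N u \<inter> {v\<in>W. card (N v \<inter> W) = 3}))"
          by (rule exists_hub[OF less.prems(1) _ k]) (use 3 in auto)
        then obtain u where k3: "k = 3" and u: "u \<in> W"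
          and hub: "3 \<le> card (N u \<inter> {v\<in>W. card (N v \<inter> W) = 3})"
          by blast
        obtain X where X: "X \<subseteq> N u \<inter> {v\<in>W. card (N v \<inter> W) = 3}" "card X = 3"
          using obtain_subset_with_card_n[OF hub] by metis
        then obtain v1 v2 v3 where v: "X = {v1,v2,v3}" "v1 \<noteq> v2" "v1 \<noteq> v3" "v2 \<noteq> v3"
          by (auto simp: card_3_iff)
        \<comment> \<open>More than \<open>k\<close> vertices force \<open>m \<ge> 2\<close>, so
          there is room for two rounds.\<close>
        obtain n' where n': "n = Suc n'" using cardW False by (cases n) auto
        have "colourable W (Suc (Suc n'))"
        proof (rule colourable_hub[OF _ less.prems(1) _ k3 u _ v(2-4)])
          show "\<And>U. U \<subseteq> V \<Longrightarrow> card U \<le> n' * 3 \<Longrightarrow> colourable U n'"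
            using less.IH[of n'] Suc n' k3 by simp
          show "card W \<le> Suc (Suc n') * 3" using cardW n' k3 by simp
          show "{v1,v2,v3} \<subseteq> N u \<inter> W" using X v by auto
          show "card (N v \<inter> W) = 3" if "v \<in> {v1,v2,v3}" for v using X v that by auto
          show "card (N x \<inter> W) \<noteq> 3" if "v \<in> {v1,v2,v3}" "x \<in> N v \<inter> W" for v x
            using 3(2)[of v x] X v that k3 by auto
        qed
        then show ?thesis using Suc n' by simp
      qed
    qed
  qed
qed

lemma colourable_if_card_le:
  assumes "1 \<le> k" and W: "W \<subseteq> V" and m: "card W \<le> m * k"
  shows "colourable W m"
proof -
  consider "k = 1" | "k = 2" | "3 \<le> k" using assms(1) by linarith
  then show ?thesis
  proof cases
    case 1
    obtain c where "arborable_on c W" using exists_arborable[OF W] by blast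
    moreover have "card {v\<in>W. c v = x} \<le> m" for x
      using card_mono[OF finite_sub[OF W], of "{v\<in>W. c v = x}"] m 1 by simp
    ultimately show ?thesis by (auto simp: colourable_def)
  next
    case 2
    then show ?thesis using colourable_two[OF W] m by (simp add: mult.commute)
  next
    case 3
    then show ?thesis using colourable_ge_three W m by simp
  qed
qed

end

section \<open>Forests, degeneracy and the sparsity given by arboricity 2\<close>

definition neighbours :: "'a set set \<Rightarrow> 'a \<Rightarrow> 'a set" where
  "neighbours E v = {w. {v,w} \<in> E}"

lemma neighbours_sym: "w \<in> neighbours E v \<Longrightarrow> v \<in> neighbours E w"
  by (simp add: neighbours_def insert_commute)

lemma not_in_neighbours: "\<forall>e\<in>E. card e = 2 \<Longrightarrow> v \<notin> neighbours E v"
  by (auto simp: neighbours_def)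

text \<open>On the vertex set of a cycle every vertex has two distinct neighbours, its predecessor
  and its successor.\<close>

lemma forest_induced_edges:
  assumes S: "one_degenerate (neighbours E) S" and fin: "finite S"
  shows "forest (induced_edges E S)"
  unfolding forest_def
proof
  assume "\<exists>p. is_cycle (induced_edges E S) p"
  then obtain p where len: "3 \<le> length p" and dist: "distinct p"
    and edge: "\<And>i. i < length p \<Longrightarrow> {p ! i, p ! (Suc i mod length p)} \<in> induced_edges E S"
    by (auto simp: is_cycle_def)
  let ?n = "length p"
  have sub: "set p \<subseteq> S"
    using edge by (fastforce simp: in_set_conv_nth induced_edges_def)
  have "set p \<noteq> {}" using len by auto
  then obtain v where v: "v \<in> set p" and deg: "card (neighbours E v \<inter> set p) \<le> 1"
    using S sub by (auto simp: one_degenerate_def)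
  then obtain i where i: "i < ?n" "v = p ! i" by (auto simp: in_set_conv_nth)
  define succ pred where "succ = Suc i mod ?n" and "pred = (if i = 0 then ?n - 1 else i - 1)"
  have bounds: "succ < ?n" "pred < ?n" using i(1) len
    by (auto simp: succ_def pred_def intro!: mod_less_divisor)
  have "Suc pred mod ?n = i" using i(1) len by (auto simp: pred_def)
  then have "{p ! pred, v} \<in> E" "{v, p ! succ} \<in> E"
    using edge[OF bounds(2)] edge[OF i(1)] i(2) by (auto simp: induced_edges_def succ_def)
  then have "{p ! pred, p ! succ} \<subseteq> neighbours E v \<inter> set p"
    using bounds by (auto simp: neighbours_def insert_commute)
  then have "card {p ! pred, p ! succ} \<le> 1"
    using deg card_mono[of "neighbours E v \<inter> set p"] by (meson finite_Int List.finite_set le_trans)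
  \<comment> \<open>Length at least 3 is what keeps the two positions apart.\<close>
  moreover have "pred \<noteq> succ"
  proof (cases "Suc i = ?n")
    case True
    then show ?thesis using len by (auto simp: pred_def succ_def)
  next
    case False
    then show ?thesis using len i(1) by (auto simp: pred_def succ_def)
  qed
  then have "p ! pred \<noteq> p ! succ" using dist bounds by (simp add: nth_eq_iff_index_eq)
  ultimately show False by simp
qed

text \<open>All neighbours of the first vertex of a longest path lie on the path, so a second neighbour
  closes a cycle.\<close>

lemma forest_one_degenerate:
  assumes F: "forest F" and loopfree: "\<forall>e\<in>F. card e = 2" and fin: "finite S"
  shows "one_degenerate (neighbours F) S"
  unfolding one_degenerate_def
proof (intro allI impI, rule ccontr)
  fix W assume W: "W \<subseteq> S" "W \<noteq> {}" and "\<not> (\<exists>v\<in>W. card (neighbours F v \<inter> W) \<le> 1)"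
  then have two: "\<And>v. v \<in> W \<Longrightarrow> 1 < card (neighbours F v \<inter> W)" by (auto simp: not_le)
  have finW: "finite W" using W(1) fin finite_subset by auto
  define path where "path p \<longleftrightarrow> p \<noteq> [] \<and> distinct p \<and> set p \<subseteq> W \<and>
    (\<forall>i. Suc i < length p \<longrightarrow> {p ! i, p ! Suc i} \<in> F)" for p
  obtain x where "x \<in> W" using W(2) by auto
  then have "path [x]" by (simp add: path_def)
  moreover have "length p \<le> card W" if "path p" for p
    using that card_mono[OF finW, of "set p"] by (auto simp: path_def distinct_card)
  ultimately obtain p where p: "path p" and longest: "\<And>q. path q \<Longrightarrow> length q \<le> length p"
    using ex_has_greatest_nat[of path "[x]" length "Suc (card W)"] by (auto simp: less_Suc_eq_le)
  let ?v = "p ! 0"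
  have v: "?v \<in> W" "0 < length p" using p by (auto simp: path_def)
  have on_path: "w \<in> set p" if w: "w \<in> neighbours F ?v" "w \<in> W" for w
  proof (rule ccontr)
    assume "w \<notin> set p"
    moreover have "{(w # p) ! i, (w # p) ! Suc i} \<in> F" if "Suc i < length (w # p)" for i
      using that p w by (cases i) (auto simp: path_def neighbours_def insert_commute)
    ultimately have "path (w # p)" using p w(2) by (simp add: path_def)
    then show False using longest by fastforce
  qed
  obtain w where w: "w \<in> neighbours F ?v" "w \<in> W" "w \<noteq> p ! 1"
    using obtain_outside[of "{p ! 1}" "neighbours F ?v \<inter> W"] two[OF v(1)] by auto
  obtain j where j: "j < length p" "w = p ! j"
    using on_path[OF w(1,2)] by (auto simp: in_set_conv_nth)
  have "j \<noteq> 0" using w(1) j not_in_neighbours[OF loopfree] by metis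
  moreover have "j \<noteq> 1" using w(3) j by auto
  ultimately have j2: "2 \<le> j" by linarith
  \<comment> \<open>The initial segment ending at \<open>w\<close> has \<open>j + 1 \<ge> 3\<close>
    vertices and is closed by the edge from \<open>w\<close> to \<open>?v\<close>.\<close>
  let ?c = "take (Suc j) p"
  have "{?c ! i, ?c ! (Suc i mod length ?c)} \<in> F" if "i < length ?c" for i
  proof (cases "i = j")
    case True
    then show ?thesis using j w(1) by (simp add: neighbours_def insert_commute)
  next
    case False
    then show ?thesis using that j(1) p by (simp add: path_def)
  qed
  then have "is_cycle F ?c" using j2 j(1) p by (simp add: is_cycle_def path_def)
  then show False using F by (auto simp: forest_def)
qed

text \<open>The sum is twice the number of edges, and a forest has at most
  \<open>card W - 1\<close>: deleting leaves one by one loses at most one edge each time, until a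
  single vertex without edges remains.\<close>

lemma one_degenerate_degree_sum:
  assumes sym: "\<And>v w. w \<in> N v \<Longrightarrow> v \<in> N w" and irr: "\<And>v. v \<notin> N v"
    and "finite W" "W \<noteq> {}" "one_degenerate N W"
  shows "(\<Sum>v\<in>W. card (N v \<inter> W)) + 2 \<le> 2 * card W"
  using assms(3-5)
proof (induction "card W" arbitrary: W)
  case 0
  then show ?case by simp
next
  case (Suc n)
  obtain x where x: "x \<in> W" "card (N x \<inter> W) \<le> 1"
    using Suc.prems by (auto simp: one_degenerate_def)
  let ?W = "W - {x}"
  have card: "card ?W = n" "card W = Suc n" using Suc x by auto
  show ?case
  proof (cases "?W = {}")
    case True
    then have "W = {x}" using x(1) by auto
    then show ?thesis using irr by simp
  next
    case False
    have "card (N v \<inter> W) = card (N v \<inter> ?W) + (if v \<in> N x then 1 else 0)" if "v \<in> ?W" for v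
    proof (cases "v \<in> N x")
      case True
      then have "N v \<inter> W = insert x (N v \<inter> ?W)" using x(1) sym by auto
      then show ?thesis using True Suc.prems(1) by simp
    next
      case False
      then have "N v \<inter> W = N v \<inter> ?W" using sym by auto
      then show ?thesis using False by simp
    qed
    then have "(\<Sum>v\<in>?W. card (N v \<inter> W)) =
        (\<Sum>v\<in>?W. card (N v \<inter> ?W)) + (\<Sum>v\<in>?W. if v \<in> N x then 1 else 0)"
      by (simp add: sum.distrib)
    also have "(\<Sum>v\<in>?W. if v \<in> N x then 1 else 0) = card (?W \<inter> N x)"
      using Suc.prems(1) by (subst sum.inter_restrict[symmetric]) auto
    also have "?W \<inter> N x = N x \<inter> W" using irr by auto
    finally have "(\<Sum>v\<in>W. card (N v \<inter> W)) = (\<Sum>v\<in>?W. card (N v \<inter> ?W)) + 2 * card (N x \<inter> W)"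
      using Suc.prems(1) x(1) by (simp add: sum.remove)
    moreover have "(\<Sum>v\<in>?W. card (N v \<inter> ?W)) + 2 \<le> 2 * card ?W"
      using Suc.hyps(1)[of ?W] card Suc.prems False one_degenerate_mono by (metis Diff_subset finite_Diff)
    ultimately show ?thesis using x(2) card by linarith
  qed
qed

lemma simple_graph_finite_edges: "simple_graph V E \<Longrightarrow> finite E"
  unfolding simple_graph_def by (meson PowI finite_Pow_iff finite_subset subsetI)

lemma forest_singleton: "forest {e}"
  unfolding forest_def
proof
  assume "\<exists>p. is_cycle {e} p"
  then obtain p where len: "3 \<le> length p" and dist: "distinct p"
    and edge: "\<And>i. i < length p \<Longrightarrow> {p ! i, p ! (Suc i mod length p)} = e"
    by (auto simp: is_cycle_def)
  have "{p ! 0, p ! 1} = {p ! 1, p ! 2}"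
    using edge[of 0] edge[of 1] len by (cases "p = []") (simp_all add: numeral_2_eq_2)
  then have "p ! 0 = p ! 2" by (auto simp: doubleton_eq_iff)
  then show False using dist len nth_eq_iff_index_eq[of p 0 2] by (cases "p = []") simp_all
qed

text \<open>The partition into singletons shows that the minimum exists, so the \<open>LEAST\<close>
  value 2 is attained by a partition.\<close>

lemma arboricity_2_forests:
  assumes fin: "finite E" and "arboricity E = 2"
  obtains F1 F2 where "E = F1 \<union> F2" "forest F1" "forest F2"
proof -
  let ?Q = "\<lambda>n. \<exists>P. partition_on E P \<and> finite P \<and> card P = n \<and> (\<forall>F\<in>P. forest F)"
  have "partition_on E ((\<lambda>e. {e}) ` E)"
    by (rule partition_onI) (auto simp: disjnt_def)
  then have "?Q (card ((\<lambda>e. {e}) ` E))"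
    using fin forest_singleton by (intro exI[of _ "(\<lambda>e. {e}) ` E"]) auto
  then have "?Q (LEAST n. ?Q n)" by (rule LeastI)
  then have "?Q 2" using assms(2) by (simp add: arboricity_def)
  then obtain P where P: "partition_on E P" "card P = 2" "\<forall>F\<in>P. forest F" by blast
  then obtain F1 F2 where "P = {F1,F2}" by (auto simp: card_2_iff)
  then show thesis using that[of F1 F2] P by (auto simp: partition_on_def)
qed

text \<open>Degrees in the union are at most the sums of the degrees in the two forests, and each
  forest accounts for a slack of 2.\<close>

lemma arboricity_2_degree_sum:
  assumes G: "simple_graph V E" and ar: "arboricity E = 2" and W: "W \<subseteq> V" "W \<noteq> {}"
  shows "(\<Sum>v\<in>W. card (neighbours E v \<inter> W)) + 4 \<le> 4 * card W"
proof -
  obtain F1 F2 where E: "E = F1 \<union> F2" and F: "forest F1" "forest F2"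
    using arboricity_2_forests[OF simple_graph_finite_edges[OF G] ar] by metis
  have finW: "finite W" using G W by (auto simp: simple_graph_def intro: finite_subset)
  have forest_sum: "(\<Sum>v\<in>W. card (neighbours F v \<inter> W)) + 2 \<le> 2 * card W"
    if "forest F" "F \<subseteq> E" for F
  proof -
    have "\<forall>e\<in>F. card e = 2" using that G by (auto simp: simple_graph_def)
    then show ?thesis
      using one_degenerate_degree_sum[of "neighbours F", OF neighbours_sym not_in_neighbours finW W(2)]
        forest_one_degenerate[OF that(1) _ finW] by blast
  qed
  have "card (neighbours E v \<inter> W) \<le> card (neighbours F1 v \<inter> W) + card (neighbours F2 v \<inter> W)" for v
  proof -
    have "neighbours E v \<inter> W = (neighbours F1 v \<inter> W) \<union> (neighbours F2 v \<inter> W)"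
      by (auto simp: E neighbours_def)
    then show ?thesis by (simp add: card_Un_le)
  qed
  then have "(\<Sum>v\<in>W. card (neighbours E v \<inter> W)) \<le>
      (\<Sum>v\<in>W. card (neighbours F1 v \<inter> W)) + (\<Sum>v\<in>W. card (neighbours F2 v \<inter> W))"
    unfolding sum.distrib[symmetric] by (intro sum_mono) auto
  then show ?thesis using forest_sum[OF F(1)] forest_sum[OF F(2)] E by auto
qed

lemma card_neighbours_le_max_degree:
  assumes G: "simple_graph V E" and v: "v \<in> V"
  shows "card (neighbours E v \<inter> V) \<le> max_degree V E"
proof -
  have "card (neighbours E v \<inter> V) = card ((\<lambda>w. {v,w}) ` (neighbours E v \<inter> V))"
    by (intro card_image[symmetric]) (auto simp: inj_on_def doubleton_eq_iff)
  also have "\<dots> \<le> degree E v"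
    unfolding degree_def using simple_graph_finite_edges[OF G]
    by (intro card_mono) (auto simp: neighbours_def)
  also have "\<dots> \<le> max_degree V E"
    using G v by (auto simp: max_degree_def simple_graph_def)
  finally show ?thesis .
qed

section \<open>Equitable list arborability from the degree bound and sparsity\<close>

theorem theorem4:
  fixes V :: "'a set" and E :: "'a set set" and k :: nat
  assumes "simple_graph V E"
    and "arboricity E = 2"
    and "int k \<ge> \<lceil>(real (max_degree V E) + 1) / 2\<rceil>"
  shows "equitably_list_arborable TYPE('c) k V E"
  unfolding equitably_list_arborable_def
proof (intro allI impI)
  fix L :: "'a \<Rightarrow> 'c set"
  assume L: "uniform_list_assignment k V L"
  have "(real (max_degree V E) + 1) / 2 \<le> real k" using assms(3) by (simp add: ceiling_le_iff)
  then have "real (max_degree V E + 1) \<le> real (2 * k)" by simp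
  \<comment> \<open>Besides the degree bound, this yields \<open>k \<ge> 1\<close>, so that dividing
    by \<open>k\<close> is meaningful.\<close>
  then have k: "max_degree V E + 1 \<le> 2 * k" by (simp only: of_nat_le_iff)
  have finV: "finite V" using assms(1) by (simp add: simple_graph_def)
  have loopfree: "\<forall>e\<in>E. card e = 2" using assms(1) by (simp add: simple_graph_def)
  interpret sparse_list_assigned_graph V "neighbours E" L k
  proof unfold_locales
    show "card (neighbours E v \<inter> V) < 2 * k" if "v \<in> V" for v
      using card_neighbours_le_max_degree[OF assms(1) that] k by linarith
  qed (use L finV arboricity_2_degree_sum[OF assms(1,2)] not_in_neighbours[OF loopfree] in
      \<open>auto simp: uniform_list_assignment_def intro: neighbours_sym\<close>)
  define m where "m = nat \<lceil>real (card V) / real k\<rceil>"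
  have "real (card V) / real k \<le> real m" unfolding m_def by (rule real_nat_ceiling_ge)
  then have "real (card V) \<le> real m * real k" using k by (simp add: field_simps)
  then have "card V \<le> m * k" by (metis of_nat_le_iff of_nat_mult)
  then obtain c where c: "arborable_on c V" and m: "\<And>x. card {v\<in>V. c v = x} \<le> m"
    using colourable_if_card_le[of V m] k by (auto simp: colourable_def)
  have "forest (induced_edges E (colour_class V c x))" for x
    using c finV by (intro forest_induced_edges) (auto simp: arborable_on_def colour_class_def)
  moreover have "0 \<le> \<lceil>real (card V) / real k\<rceil>" by (simp add: order_less_le_trans[of _ 0])
  then have "int m = \<lceil>real (card V) / real k\<rceil>" by (simp add: m_def)
  then have "equitable k V c"
    unfolding equitable_def colour_class_def using m by (metis of_nat_le_iff)
  moreover have "list_colouring V L c" using c by (simp add: arborable_on_def list_colouring_def)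
  ultimately show "\<exists>c. list_colouring V L c \<and> equitable k V c \<and>
      (\<forall>x. forest (induced_edges E (colour_class V c x)))" by blast
qed

end
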